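(* Let $k\ge 3$ and $n\ge 1$ be integers such that $\log_k n$ is an integer. Then for every integer $d$ with $1\le d\le \log_k n$ there exists a $d$-regular $k$-uniform hypergraph $G$ with $n$ vertices whose tensor entropy $S(G)$ equals the maximum of the tensor entropy over all $k$-uniform hypergraphs with $n$ vertices and nonempty hyperedge set.
   Context: A $k$-uniform hypergraph $G=(V,E)$ with $n$ vertices has $V=\{1,\dots,n\}$ and $E$ a set of $k$-element subsets of $V$ (the hyperedges). $G$ is $d$-regular if every vertex is contained in exactly $d$ hyperedges. Its adjacency tensor $A\in\mathbb{R}^{n\times\cdots\times n}$ (order $k$) has entries $A_{j_1\dots j_k}=\frac{1}{(k-1)!}$ if $j_1,\dots,j_k$ are distinct and $\{j_1,\dots,j_k\}\in E$, and $0$ otherwise. Its degree tensor $D$ (order $k$, dimension $n$) is diagonal, with $D_{jj\dots j}$ equal to the number of hyperedges containing vertex $j$ and all other entries $0$. The Laplacian tensor is $L=D-A$. The $k$-mode unfolding $L_{(k)}\in\mathbb{R}^{n\times n^{k-1}}$ is the matrix whose rows are indexed by $j_k$ and columns by $(j_1,\dots,j_{k-1})$, with entry $L_{j_1\dots j_k}$ (since $L$ is invariant under permutations of its indices, unfolding along any mode gives the same matrix). The $k$-mode singular values $\gamma_1,\dots,\gamma_n\ge 0$ of $L$ are the $n$ singular values of $L_{(k)}$, i.e. the square roots of the eigenvalues of $L_{(k)}L_{(k)}^\top\in\mathbb{R}^{n\times n}$, counted with multiplicity. For $E\neq\emptyset$, the tensor entropy of $G$ is $S(G)=-\sum_{j=1}^n\hat\gamma_j\ln\hat\gamma_j$,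 where $\hat\gamma_j=\gamma_j/\sum_{i=1}^n\gamma_i$ and $0\ln 0=0$. *)

theory Defs
  imports
    Complex_Main
    "HOL-Library.Multiset"
    "HOL-Computational_Algebra.Polynomial"
    "Jordan_Normal_Form.Char_Poly"
begin

text \<open>
  A hypergraph on the vertex set \<open>{1..n}\<close> is represented by its set of hyperedges.
\<close>

definition uniform_hypergraph :: "nat \<Rightarrow> nat \<Rightarrow> nat set set \<Rightarrow> bool" where
  "uniform_hypergraph k n E \<longleftrightarrow> (\<forall>e\<in>E. e \<subseteq> {1..n} \<and> card e = k)"

definition vertex_degree :: "nat set set \<Rightarrow> nat \<Rightarrow> nat" where
  "vertex_degree E v = card {e \<in> E. v \<in> e}"

definition regular_hypergraph :: "nat \<Rightarrow> nat \<Rightarrow> nat set set \<Rightarrow> bool" where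
  "regular_hypergraph d n E \<longleftrightarrow> (\<forall>v\<in>{1..n}. vertex_degree E v = d)"

text \<open>
  A tensor of order \<open>k\<close> and dimension \<open>n\<close> is a function on index lists; only its values
  on lists of length \<open>k\<close> with entries in \<open>{1..n}\<close> are meaningful.
\<close>

type_synonym tensor = "nat list \<Rightarrow> real"

definition adjacency_tensor :: "nat \<Rightarrow> nat set set \<Rightarrow> tensor" where
  "adjacency_tensor k E js =
     (if distinct js \<and> set js \<in> E then 1 / fact (k - 1) else 0)"

definition degree_tensor :: "nat set set \<Rightarrow> tensor" where
  "degree_tensor E js =
     (if set js = {hd js} then real (vertex_degree E (hd js)) else 0)"

definition laplacian_tensor :: "nat \<Rightarrow> nat set set \<Rightarrow> tensor" where
  "laplacian_tensor k E js = degree_tensor E js - adjacency_tensor k E js"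

text \<open>
  Matrices are indexed from \<open>0\<close>, so row \<open>i\<close> stands for \<open>j\<^sub>k = i + 1\<close>. The base-\<open>n\<close> digits
  of the column number \<open>c < n ^ (k - 1)\<close>, each increased by \<open>1\<close>, enumerate the tuples
  \<open>(j\<^sub>1, \<dots>, j\<^sub>k\<^sub>-\<^sub>1)\<close>, with \<open>j\<^sub>1\<close> varying fastest.
\<close>

definition unfolding_index :: "nat \<Rightarrow> nat \<Rightarrow> nat \<Rightarrow> nat list" where
  "unfolding_index k n c = map (\<lambda>l. c div n ^ l mod n + 1) [0..<k - 1]"

definition mode_unfolding :: "nat \<Rightarrow> nat \<Rightarrow> tensor \<Rightarrow> real mat" where
  "mode_unfolding k n T =
     mat n (n ^ (k - 1)) (\<lambda>(i, c). T (unfolding_index k n c @ [i + 1]))"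

text \<open>
  The multiset \<open>proots p\<close> contains each root of \<open>p\<close> as often as its multiplicity. Since
  \<open>M M\<^sup>T\<close> is real symmetric, its characteristic polynomial splits over the reals, so one
  singular value is obtained per row of \<open>M\<close>.
\<close>

definition singular_values :: "real mat \<Rightarrow> real multiset" where
  "singular_values M = image_mset sqrt (proots (char_poly (M * transpose_mat M)))"

definition mode_singular_values :: "nat \<Rightarrow> nat \<Rightarrow> nat set set \<Rightarrow> real multiset" where
  "mode_singular_values k n E =
     singular_values (mode_unfolding k n (laplacian_tensor k E))"

text \<open>
  The convention \<open>0 ln 0 = 0\<close> holds automatically.
\<close>

definition tensor_entropy :: "nat \<Rightarrow> nat \<Rightarrow> nat set set \<Rightarrow> real" where
  "tensor_entropy k n E =
     (let \<Gamma> = mode_singular_values k n E; s = sum_mset \<Gamma>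
      in - (\<Sum>\<gamma>\<in>#\<Gamma>. (\<gamma> / s) * ln (\<gamma> / s)))"

end

theory Submission
  imports Defs "HOL-Combinatorics.Multiset_Permutations"
begin

text \<open>
  The entropy of \<open>n\<close> nonnegative numbers is at most \<open>ln n\<close>, with equality if they are all
  equal and positive. If no two hyperedges share \<open>k - 1\<close> vertices, the rows of the unfolded
  Laplacian are pairwise orthogonal; if moreover the hypergraph is \<open>d\<close>-regular, they all have
  squared norm \<open>d\<^sup>2 + d / (k - 1)!\<close>, so all singular values agree. For \<open>n = k\<^sup>m\<close>, the
  axis-parallel lines of \<open>{0..<k}\<^sup>m\<close> in \<open>d \<le> m\<close> of the \<open>m\<close> directions form such a
  hypergraph: distinct lines meet in at most one point, and \<open>1 < k - 1\<close>.
\<close>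

section \<open>Columns of the unfolding as index tuples\<close>

text \<open>Induction on the number of digits: \<open>c mod n\<close> is the lowest digit and
  \<open>c div n\<close> carries the others, shifted by one place.\<close>

lemma eq_if_base_digits_eq:
  fixes c c' n m :: nat
  assumes "c < n ^ m" "c' < n ^ m"
    and "\<And>l. l < m \<Longrightarrow> c div n ^ l mod n = c' div n ^ l mod n"
  shows "c = c'"
  using assms
proof (induction m arbitrary: c c')
  case 0
  then show ?case by simp
next
  case (Suc m)
  have "c div n = c' div n"
  proof (rule Suc.IH)
    show "c div n < n ^ m" "c' div n < n ^ m"
      using Suc.prems(1,2) by (simp_all add: less_mult_imp_div_less mult.commute)
    show "c div n div n ^ l mod n = c' div n div n ^ l mod n" if "l < m" for l
      using Suc.prems(3)[of "Suc l"] that by (simp add: div_mult2_eq)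
  qed
  moreover have "c mod n = c' mod n"
    using Suc.prems(3)[of 0] by simp
  ultimately show ?case
    by (metis div_mult_mod_eq)
qed

text \<open>Injective because digits determine the number; onto because both sides have
  \<open>n ^ (k - 1)\<close> elements.\<close>

lemma bij_betw_unfolding_index:
  assumes "n \<ge> 1"
  shows "bij_betw (unfolding_index k n) {0..<n ^ (k - 1)}
           {xs. set xs \<subseteq> {1..n} \<and> length xs = k - 1}"
    (is "bij_betw ?f ?A ?B")
proof -
  have inj: "inj_on ?f ?A"
  proof (rule inj_onI)
    fix c c' assume c: "c \<in> ?A" "c' \<in> ?A" and eq: "?f c = ?f c'"
    show "c = c'"
    proof (rule eq_if_base_digits_eq)
      show "c div n ^ l mod n = c' div n ^ l mod n" if "l < k - 1" for l
        using arg_cong[OF eq, of "\<lambda>xs. xs ! l"] that by (simp add: unfolding_index_def)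
    qed (use c in auto)
  qed
  have "?f ` ?A \<subseteq> ?B"
    using assms by (auto simp: unfolding_index_def Suc_le_eq)
  moreover have "card (?f ` ?A) = card ?B"
    using card_image[OF inj] by (simp add: card_lists_length_eq)
  ultimately have "?f ` ?A = ?B"
    by (intro card_subset_eq) (auto simp: finite_lists_length_eq)
  with inj show ?thesis by (simp add: bij_betw_def)
qed

text \<open>Replaces column numbers by index tuples, so that inner products of rows can be computed
  without digit arithmetic.\<close>

lemma gram_mode_unfolding:
  assumes "i < n" "j < n"
  shows "(mode_unfolding k n T * transpose_mat (mode_unfolding k n T)) $$ (i, j) =
           (\<Sum>xs | set xs \<subseteq> {1..n} \<and> length xs = k - 1. T (xs @ [i + 1]) * T (xs @ [j + 1]))"
proof -
  have "(mode_unfolding k n T * transpose_mat (mode_unfolding k n T)) $$ (i, j) =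
          (\<Sum>c = 0..<n ^ (k - 1). T (unfolding_index k n c @ [i + 1]) * T (unfolding_index k n c @ [j + 1]))"
    using assms by (simp add: mode_unfolding_def scalar_prod_def)
  also have "\<dots> = (\<Sum>xs | set xs \<subseteq> {1..n} \<and> length xs = k - 1. T (xs @ [i + 1]) * T (xs @ [j + 1]))"
    using bij_betw_unfolding_index[of n k] assms
    by (intro sum.reindex_bij_betw[where g = "\<lambda>xs. T (xs @ [i + 1]) * T (xs @ [j + 1])"]) auto
  finally show ?thesis .
qed

section \<open>Singular values of real matrices\<close>

lemma gram_carrier:
  fixes M :: "real mat"
  shows "M * transpose_mat M \<in> carrier_mat (dim_row M) (dim_row M)"
  by auto

lemma size_singular_values_le: "size (singular_values M) \<le> dim_row M"
  using size_proots_le[of "char_poly (M * transpose_mat M)"]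
    degree_monic_char_poly[OF gram_carrier[of M]]
  by (simp add: singular_values_def)

text \<open>The Gram matrix is positive semidefinite: with \<open>?w\<close> the transpose of
  \<open>M\<close> applied to an eigenvector \<open>v\<close> for \<open>y\<close>, the squared norm
  of \<open>?w\<close> is \<open>y\<close> times that of \<open>v\<close>. The sign of
  \<open>y\<close> matters because \<open>sqrt\<close> of a negative real is negative in
  HOL.\<close>

lemma singular_values_nonneg:
  assumes "x \<in># singular_values M"
  shows "0 \<le> x"
proof -
  let ?n = "dim_row M" and ?A = "M * transpose_mat M"
  obtain y where y: "y \<in># proots (char_poly ?A)" and x: "x = sqrt y"
    using assms by (auto simp: singular_values_def)
  have "char_poly ?A \<noteq> 0"
    using degree_monic_char_poly[OF gram_carrier[of M]] by auto
  then have "poly (char_poly ?A) y = 0"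
    using y by simp
  then obtain v where "eigenvector ?A v y"
    using eigenvalue_root_char_poly[OF gram_carrier[of M]] by (auto simp: eigenvalue_def)
  then have v: "v \<in> carrier_vec ?n" and v0: "v \<noteq> 0\<^sub>v ?n" and Av: "?A *\<^sub>v v = y \<cdot>\<^sub>v v"
    by (auto simp: eigenvector_def)
  have M: "M \<in> carrier_mat ?n (dim_col M)" by simp
  let ?w = "transpose_mat M *\<^sub>v v"
  have w: "?w \<in> carrier_vec (dim_col M)"
    using mult_mat_vec_carrier[OF _ v] by simp
  have "?w \<bullet> ?w = v \<bullet> (M *\<^sub>v ?w)"
    using transpose_vec_mult_scalar[OF M w v] .
  also have "M *\<^sub>v ?w = ?A *\<^sub>v v"
    using assoc_mult_mat_vec[OF M _ v] by simp
  also have "v \<bullet> (?A *\<^sub>v v) = y * (v \<bullet> v)"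
    using v by (simp add: Av)
  finally have eq: "?w \<bullet> ?w = y * (v \<bullet> v)" .
  have "0 \<le> ?w \<bullet> ?w"
    by (simp add: scalar_prod_def sum_nonneg)
  moreover have "0 < v \<bullet> v"
  proof -
    obtain i where i: "i < ?n" "v $ i \<noteq> 0"
      using v v0 by (metis carrier_vecD eq_vecI index_zero_vec)
    then show ?thesis
      using v unfolding scalar_prod_def
      by (intro sum_pos2[of _ i]) (auto simp: zero_less_mult_iff linorder_neq_iff)
  qed
  ultimately have "0 \<le> y"
    using eq by (simp add: zero_le_mult_iff)
  then show ?thesis by (simp add: x)
qed

lemma singular_values_if_gram_scalar:
  assumes "M * transpose_mat M = c \<cdot>\<^sub>m 1\<^sub>m n"
  shows "singular_values M = replicate_mset n (sqrt c)"
proof -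
  have "char_poly (c \<cdot>\<^sub>m 1\<^sub>m n) = (\<Prod>a\<leftarrow>diag_mat (c \<cdot>\<^sub>m 1\<^sub>m n). [:- a, 1:])"
    by (rule char_poly_upper_triangular[where n = n]) (auto intro: upper_triangularI)
  also have "diag_mat (c \<cdot>\<^sub>m 1\<^sub>m n) = replicate n c"
    by (auto simp: diag_mat_def list_eq_iff_nth_eq)
  finally have "char_poly (M * transpose_mat M) = [:- c, 1:] ^ n"
    by (simp add: assms prod_list_replicate)
  moreover have "repeat_mset n {#c#} = replicate_mset n c"
    by (rule multiset_eqI) simp
  ultimately show ?thesis
    by (simp add: singular_values_def proots_power)
qed

section \<open>The upper bound \<open>ln n\<close> on the entropy\<close>

lemma sum_mset_affine:
  fixes a b :: real
  shows "(\<Sum>x\<in>#G. a + b * x) = a * size G + b * sum_mset G"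
  by (induction G) (simp_all add: algebra_simps)

text \<open>Gibbs' inequality against the uniform distribution: each term is bounded below by an
  affine function of \<open>x\<close>, and these bounds add up explicitly.\<close>

lemma mset_entropy_le_ln:
  fixes G :: "real multiset"
  assumes nonneg: "\<And>x. x \<in># G \<Longrightarrow> 0 \<le> x" and size: "size G \<le> n" and n: "n \<ge> 1"
  shows "- (\<Sum>x\<in>#G. (x / sum_mset G) * ln (x / sum_mset G)) \<le> ln n"
proof (cases "sum_mset G = 0")
  \<comment> \<open>Division by zero yields 0, so the entropy is 0 here.\<close>
  case True
  then show ?thesis using n by simp
next
  case False
  define s where "s = sum_mset G"
  have "0 \<le> s"
    using sum_mset_mono[of G "\<lambda>_. 0" "\<lambda>x. x"] nonneg by (simp add: s_def)
  with False have s: "0 < s" by (simp add: s_def)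
  \<comment> \<open>With \<open>p = x / s\<close>, the left-hand side is the tangent at
    \<open>p = 1 / n\<close> to the convex function \<open>p * ln p\<close>.\<close>
  have gibbs: "- 1 / n + ((1 - ln n) / s) * x \<le> (x / s) * ln (x / s)" if "x \<in># G" for x
  proof (cases "x = 0")
    case True
    then show ?thesis by simp
  next
    case False
    define p where "p = x / s"
    have p: "0 < p" using False nonneg[OF that] s by (simp add: p_def)
    have "ln (1 / (n * p)) \<le> 1 / (n * p) - 1"
      using p n by (intro ln_le_minus_one) simp
    then have "p * ln (1 / (n * p)) \<le> p * (1 / (n * p) - 1)"
      using p by (intro mult_left_mono) auto
    moreover have "ln (1 / (n * p)) = - ln n - ln p"
      using p n by (simp add: ln_div ln_mult)
    moreover have "p * (1 / (n * p) - 1) = 1 / n - p"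
      using p n by (simp add: field_simps)
    ultimately have "p * (- ln n - ln p) \<le> 1 / n - p"
      by simp
    then have "- 1 / n + (1 - ln n) * p \<le> p * ln p"
      by (simp add: algebra_simps)
    then show ?thesis by (simp add: p_def)
  qed
  \<comment> \<open>Each element costs \<open>1 / n\<close>, so at most \<open>n\<close> elements
    cost at most 1 in total.\<close>
  have "real (size G) / n \<le> 1"
    using size n by simp
  then have "- ln n \<le> - 1 / n * size G + ((1 - ln n) / s) * s"
    using s by simp
  also have "\<dots> = (\<Sum>x\<in>#G. - 1 / n + ((1 - ln n) / s) * x)"
    by (simp only: sum_mset_affine s_def)
  also have "\<dots> \<le> (\<Sum>x\<in>#G. (x / s) * ln (x / s))"
    by (intro sum_mset_mono gibbs)
  finally show ?thesis by (simp add: s_def)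
qed

lemma tensor_entropy_le_ln:
  assumes "n \<ge> 1"
  shows "tensor_entropy k n E \<le> ln n"
proof -
  have "size (mode_singular_values k n E) \<le> n"
    using size_singular_values_le[of "mode_unfolding k n (laplacian_tensor k E)"]
    by (simp add: mode_singular_values_def mode_unfolding_def)
  then show ?thesis
    unfolding tensor_entropy_def Let_def using assms
    by (intro mset_entropy_le_ln) (auto simp: mode_singular_values_def intro: singular_values_nonneg)
qed

lemma tensor_entropy_eq_ln:
  assumes "n \<ge> 1" "c > 0" "mode_singular_values k n E = replicate_mset n c"
  shows "tensor_entropy k n E = ln n"
  using assms by (simp add: tensor_entropy_def ln_div ln_mult)

section \<open>The Gram matrix of the unfolded Laplacian\<close>

text \<open>If \<open>xs\<close> is distinct, the degree entries vanish, and two nonzero adjacency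
  entries would give different hyperedges sharing the \<open>k - 1\<close> vertices of
  \<open>xs\<close>. Otherwise the adjacency entries vanish, and \<open>xs\<close> cannot be
  constantly \<open>i\<close> and constantly \<open>j\<close>.\<close>

lemma laplacian_tensor_mult_off_diag:
  assumes k: "k \<ge> 3"
    and uniform: "\<And>e. e \<in> E \<Longrightarrow> card e = k"
    and sparse: "\<And>e f. e \<in> E \<Longrightarrow> f \<in> E \<Longrightarrow> e \<noteq> f \<Longrightarrow> card (e \<inter> f) < k - 1"
    and xs: "length xs = k - 1" and ij: "i \<noteq> j"
  shows "laplacian_tensor k E (xs @ [i]) * laplacian_tensor k E (xs @ [j]) = 0"
proof (cases "distinct xs")
  case True
  have deg: "degree_tensor E (xs @ [v]) = 0" for v
  proof -
    \<comment> \<open>\<open>remdups_adj.cases\<close> separates lists with no, one, or at least two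
      entries; \<open>k >= 3\<close> leaves the last kind.\<close>
    obtain a b ys where "xs = a # b # ys"
      using k xs by (cases xs rule: remdups_adj.cases) auto
    with True show ?thesis by (auto simp: degree_tensor_def)
  qed
  have "\<not> (distinct (xs @ [i]) \<and> set (xs @ [i]) \<in> E \<and> distinct (xs @ [j]) \<and> set (xs @ [j]) \<in> E)"
  proof
    assume *: "distinct (xs @ [i]) \<and> set (xs @ [i]) \<in> E \<and> distinct (xs @ [j]) \<and> set (xs @ [j]) \<in> E"
    have "set (xs @ [i]) \<noteq> set (xs @ [j])"
      using * ij by auto
    then have "card (set (xs @ [i]) \<inter> set (xs @ [j])) < k - 1"
      using * by (intro sparse) auto
    moreover have "card (set xs) \<le> card (set (xs @ [i]) \<inter> set (xs @ [j]))"
      by (intro card_mono) auto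
    ultimately show False
      using True xs by (simp add: distinct_card)
  qed
  then show ?thesis
    by (auto simp: laplacian_tensor_def deg adjacency_tensor_def)
next
  case False
  have "degree_tensor E (xs @ [i]) = 0 \<or> degree_tensor E (xs @ [j]) = 0"
    using ij k xs by (cases xs) (auto simp: degree_tensor_def)
  with False show ?thesis
    by (auto simp: laplacian_tensor_def adjacency_tensor_def)
qed

text \<open>The degree and adjacency tensors have disjoint supports, so the mixed term of the square
  vanishes.\<close>

lemma laplacian_tensor_square:
  assumes k: "k \<ge> 3" and xs: "length xs = k - 1"
  shows "(laplacian_tensor k E (xs @ [i]))\<^sup>2 =
           (if xs = replicate (k - 1) i then (real (vertex_degree E i))\<^sup>2 else 0) +
           (if distinct (xs @ [i]) \<and> set (xs @ [i]) \<in> E then (1 / fact (k - 1))\<^sup>2 else 0)"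
proof -
  obtain a b ys where ab: "xs = a # b # ys"
    using k xs by (cases xs rule: remdups_adj.cases) auto
  have "set (xs @ [i]) = {hd (xs @ [i])} \<longleftrightarrow> xs = replicate (k - 1) i"
  proof
    assume *: "set (xs @ [i]) = {hd (xs @ [i])}"
    then have "hd (xs @ [i]) = i" by auto
    with * have "\<forall>x\<in>set xs. x = i" by auto
    then show "xs = replicate (k - 1) i"
      using xs by (metis replicate_length_same)
  next
    assume "xs = replicate (k - 1) i"
    then show "set (xs @ [i]) = {hd (xs @ [i])}"
      using k by (cases "k - 1") auto
  qed
  moreover have "hd (xs @ [i]) = i" if "xs = replicate (k - 1) i"
    using that k by (cases "k - 1") auto
  ultimately have deg: "degree_tensor E (xs @ [i]) =
      (if xs = replicate (k - 1) i then real (vertex_degree E i) else 0)"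
    by (auto simp: degree_tensor_def)
  have disjoint: "\<not> (distinct (xs @ [i]) \<and> set (xs @ [i]) \<in> E)" if "xs = replicate (k - 1) i"
  proof -
    have "i \<in> set xs" by (subst that) (use k in auto)
    then show ?thesis by simp
  qed
  have square: "((if P then a else 0) - (if Q then b else 0))\<^sup>2 =
      (if P then a\<^sup>2 else 0) + (if Q then b\<^sup>2 else 0)" if "P \<Longrightarrow> \<not> Q" for P Q and a b :: real
    using that by simp
  show ?thesis
    unfolding laplacian_tensor_def deg adjacency_tensor_def
    by (rule square) (rule disjoint)
qed

text \<open>Each hyperedge through \<open>i\<close> contributes the \<open>fact (k - 1)\<close>
  orderings of its other vertices; different hyperedges contribute different lists, since
  \<open>insert i (set xs)\<close> recovers the hyperedge.\<close>

lemma card_edge_orderings: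
  assumes k: "k \<ge> 1" and E: "uniform_hypergraph k n E"
  shows "card {xs. set xs \<subseteq> {1..n} \<and> length xs = k - 1 \<and> distinct (xs @ [i]) \<and> set (xs @ [i]) \<in> E}
           = vertex_degree E i * fact (k - 1)"
proof -
  have sub: "e \<subseteq> {1..n}" and card: "card e = k" and fin: "finite e" if "e \<in> E" for e
    using E that by (auto simp: uniform_hypergraph_def intro: finite_subset)
  have finE: "finite E"
    by (rule finite_subset[of _ "Pow {1..n}"]) (use sub in auto)
  have "{xs. set xs \<subseteq> {1..n} \<and> length xs = k - 1 \<and> distinct (xs @ [i]) \<and> set (xs @ [i]) \<in> E}
      = (\<Union>e\<in>{e \<in> E. i \<in> e}. permutations_of_set (e - {i}))" (is "?L = ?R")
  proof (intro equalityI subsetI)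
    fix xs assume "xs \<in> ?L"
    then show "xs \<in> ?R"
      by (intro UN_I[of "set (xs @ [i])"]) (auto simp: permutations_of_set_def)
  next
    fix xs assume "xs \<in> ?R"
    then obtain e where e: "e \<in> E" "i \<in> e" "set xs = e - {i}" "distinct xs"
      by (auto simp: permutations_of_set_def)
    then have "length xs = k - 1"
      using card[of e] fin[of e] by (metis distinct_card card_Diff_singleton)
    moreover have "insert i (set xs) = e" using e by auto
    ultimately show "xs \<in> ?L"
      using e sub[of e] by auto
  qed
  also have "card \<dots> = (\<Sum>e\<in>{e \<in> E. i \<in> e}. card (permutations_of_set (e - {i})))"
  proof (rule card_UN_disjoint)
    show "\<forall>e\<in>{e \<in> E. i \<in> e}. \<forall>f\<in>{e \<in> E. i \<in> e}. e \<noteq> f \<longrightarrow>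
        permutations_of_set (e - {i}) \<inter> permutations_of_set (f - {i}) = {}"
      by (auto simp: permutations_of_set_def)
  qed (use finE in auto)
  also have "\<dots> = (\<Sum>e\<in>{e \<in> E. i \<in> e}. fact (k - 1))"
    using card fin by (intro sum.cong) auto
  finally show ?thesis by (simp add: vertex_degree_def)
qed

text \<open>On the diagonal, the constant tuple gives the square of \<open>d\<close>, and
  \<open>d * fact (k - 1)\<close> orderings of hyperedges give the square of
  \<open>1 / fact (k - 1)\<close> each. Off the diagonal every summand is 0.\<close>

lemma gram_laplacian_unfolding:
  fixes k n d E
  defines "M \<equiv> mode_unfolding k n (laplacian_tensor k E)"
  assumes k: "k \<ge> 3" and E: "uniform_hypergraph k n E" "regular_hypergraph d n E"
    and sparse: "\<And>e f. e \<in> E \<Longrightarrow> f \<in> E \<Longrightarrow> e \<noteq> f \<Longrightarrow> card (e \<inter> f) < k - 1"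
  shows "M * transpose_mat M = ((real d)\<^sup>2 + d / fact (k - 1)) \<cdot>\<^sub>m 1\<^sub>m n" (is "_ = ?c \<cdot>\<^sub>m _")
proof (rule eq_matI)
  fix i j assume "i < dim_row (?c \<cdot>\<^sub>m 1\<^sub>m n)" "j < dim_col (?c \<cdot>\<^sub>m 1\<^sub>m n)"
  then have ij: "i < n" "j < n" by auto
  let ?X = "{xs. set xs \<subseteq> {1..n} \<and> length xs = k - 1}"
  let ?L = "laplacian_tensor k E"
  have fin: "finite ?X" by (simp add: finite_lists_length_eq)
  have entry: "(M * transpose_mat M) $$ (i, j) = (\<Sum>xs\<in>?X. ?L (xs @ [i + 1]) * ?L (xs @ [j + 1]))"
    unfolding M_def by (rule gram_mode_unfolding[OF ij])
  show "(M * transpose_mat M) $$ (i, j) = (?c \<cdot>\<^sub>m 1\<^sub>m n) $$ (i, j)"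
  proof (cases "i = j")
    case False
    have "?L (xs @ [i + 1]) * ?L (xs @ [j + 1]) = 0" if "xs \<in> ?X" for xs
      using that False E(1)
      by (intro laplacian_tensor_mult_off_diag[OF k _ sparse]) (auto simp: uniform_hypergraph_def)
    then have "(M * transpose_mat M) $$ (i, j) = 0"
      unfolding entry by (rule sum.neutral[OF ballI])
    then show ?thesis
      using ij False by simp
  next
    case True
    have deg: "vertex_degree E (i + 1) = d"
      using E(2) ij by (simp add: regular_hypergraph_def)
    have "(\<Sum>xs\<in>?X. ?L (xs @ [i + 1]) * ?L (xs @ [j + 1])) =
        (\<Sum>xs\<in>?X. if xs = replicate (k - 1) (i + 1) then (real d)\<^sup>2 else 0) +
        (\<Sum>xs\<in>?X. if distinct (xs @ [i + 1]) \<and> set (xs @ [i + 1]) \<in> E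
                    then (1 / fact (k - 1))\<^sup>2 else 0)"
      unfolding sum.distrib[symmetric] True[symmetric] power2_eq_square[symmetric]
      by (intro sum.cong refl) (use laplacian_tensor_square[OF k] deg in auto)
    also have "(\<Sum>xs\<in>?X. if xs = replicate (k - 1) (i + 1) then (real d)\<^sup>2 else 0) = (real d)\<^sup>2"
      using ij fin by (subst sum.delta) auto
    also have "(\<Sum>xs\<in>?X. if distinct (xs @ [i + 1]) \<and> set (xs @ [i + 1]) \<in> E
                    then (1 / fact (k - 1))\<^sup>2 else 0)
        = real (card {xs. set xs \<subseteq> {1..n} \<and> length xs = k - 1 \<and> distinct (xs @ [i + 1]) \<and>
                        set (xs @ [i + 1]) \<in> E}) * (1 / fact (k - 1))\<^sup>2"
      using fin by (simp add: sum.If_cases Int_def conj_assoc)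
    also have "\<dots> = d / fact (k - 1)"
      using card_edge_orderings[OF _ E(1), of "i + 1"] k unfolding deg
      by (simp add: power2_eq_square)
    finally have "(M * transpose_mat M) $$ (i, j) = ?c"
      unfolding entry .
    then show ?thesis
      using True ij by simp
  qed
qed (auto simp: M_def mode_unfolding_def)

section \<open>Axis-parallel lines in the grid of base-\<open>k\<close> digits\<close>

text \<open>
  The vertex \<open>v\<close> stands for the point of \<open>{0..<k}\<^sup>m\<close> whose coordinates are the base-\<open>k\<close>
  digits of \<open>v - 1\<close>; \<open>digit_line k t u\<close> is the line through \<open>u + 1\<close> in direction \<open>t\<close>.
\<close>

definition digit_line :: "nat \<Rightarrow> nat \<Rightarrow> nat \<Rightarrow> nat set" where
  "digit_line k t u = Suc ` {w. w div k ^ Suc t = u div k ^ Suc t \<and> w mod k ^ t = u mod k ^ t}"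

lemma mem_digit_line_iff:
  "Suc v \<in> digit_line k t u \<longleftrightarrow> v div k ^ Suc t = u div k ^ Suc t \<and> v mod k ^ t = u mod k ^ t"
  by (auto simp: digit_line_def)

text \<open>The quotient by \<open>k ^ Suc t\<close> holds the digits above position
  \<open>t\<close>, the remainder modulo \<open>k ^ t\<close> those below. Agreement in all of them
  is an equivalence relation, and lines in direction \<open>t\<close> are its classes.\<close>

lemma digit_line_eq_iff: "digit_line k t v = digit_line k t u \<longleftrightarrow> Suc v \<in> digit_line k t u"
proof
  assume "digit_line k t v = digit_line k t u"
  then show "Suc v \<in> digit_line k t u" by (metis mem_digit_line_iff)
next
  assume "Suc v \<in> digit_line k t u"
  then show "digit_line k t v = digit_line k t u"
    unfolding mem_digit_line_iff by (simp add: digit_line_def)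
qed

lemma card_digit_line:
  assumes k: "k \<ge> 1"
  shows "card (digit_line k t u) = k"
proof -
  let ?S = "{w. w div k ^ Suc t = u div k ^ Suc t \<and> w mod k ^ t = u mod k ^ t}"
  \<comment> \<open>\<open>?f a\<close> has digit \<open>a\<close> at position \<open>t\<close> and
    the digits of \<open>u\<close> elsewhere.\<close>
  let ?f = "\<lambda>a. (u div k ^ Suc t * k + a) * k ^ t + u mod k ^ t"
  have r: "u mod k ^ t < k ^ t" using k by simp
  have "?S = ?f ` {..<k}"
  proof (intro equalityI subsetI)
    fix w assume w: "w \<in> ?S"
    have "w = (w div k ^ t) * k ^ t + w mod k ^ t"
      by (rule div_mult_mod_eq[symmetric])
    also have "w div k ^ t = (w div k ^ t) div k * k + (w div k ^ t) mod k"
      by (rule div_mult_mod_eq[symmetric])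
    also have "(w div k ^ t) div k = w div k ^ Suc t"
      by (metis div_mult2_eq power_Suc2)
    finally have "w = ?f ((w div k ^ t) mod k)" using w by simp
    then show "w \<in> ?f ` {..<k}" using k by (intro image_eqI) auto
  next
    fix w assume "w \<in> ?f ` {..<k}"
    then obtain a where a: "a < k" and w: "w = ?f a" by auto
    have "w div k ^ t = u div k ^ Suc t * k + a"
      using r k unfolding w by simp
    then have "w div k ^ t div k = u div k ^ Suc t"
      using a by simp
    moreover have "w div k ^ t div k = w div k ^ Suc t"
      by (metis div_mult2_eq power_Suc2)
    moreover have "w mod k ^ t = u mod k ^ t"
      unfolding w by simp
    ultimately show "w \<in> ?S" by simp
  qed
  moreover have "inj_on ?f {..<k}"
    using k by (auto simp: inj_on_def)
  ultimately show ?thesis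
    by (simp add: digit_line_def card_image)
qed

text \<open>As \<open>t < m\<close>, whether \<open>w < k ^ m\<close> depends only on
  \<open>w div k ^ Suc t\<close>, which is constant along the line.\<close>

lemma digit_line_subset:
  assumes "t < m" "u < k ^ m"
  shows "digit_line k t u \<subseteq> {1..k ^ m}"
proof
  fix v assume "v \<in> digit_line k t u"
  then obtain w where v: "v = Suc w" and w: "w div k ^ Suc t = u div k ^ Suc t"
    by (auto simp: digit_line_def)
  have m: "k ^ m = k ^ (m - Suc t) * k ^ Suc t"
    using assms(1) by (metis Suc_leI le_add_diff_inverse2 power_add)
  \<comment> \<open>Since \<open>m > 0\<close>, \<open>k = 0\<close> would make \<open>k ^ m\<close>
    zero, contradicting \<open>u < k ^ m\<close>.\<close>
  have "0 < k" using assms by (cases k) (auto simp: power_0_left split: if_splits)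
  moreover have "u div k ^ Suc t < k ^ (m - Suc t)"
    using assms(2) by (simp only: m less_mult_imp_div_less)
  ultimately have "w < k ^ m"
    unfolding m w[symmetric] by (subst (asm) div_less_iff_less_mult) auto
  then show "v \<in> {1..k ^ m}" by (simp add: v)
qed

text \<open>Two common points agree above position \<open>t\<close> by the first line, and below
  position \<open>s\<close>, hence up to and including \<open>t\<close>, by the second.\<close>

lemma digit_lines_meet_once:
  assumes "t < s" "x \<in> digit_line k t u \<inter> digit_line k s v" "y \<in> digit_line k t u \<inter> digit_line k s v"
  shows "x = y"
proof -
  obtain a b where a: "x = Suc a" and b: "y = Suc b"
    using assms by (auto simp: digit_line_def)
  have "a div k ^ Suc t = b div k ^ Suc t" and s: "a mod k ^ s = b mod k ^ s"
    using assms unfolding a b by (auto simp: mem_digit_line_iff)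
  moreover have "a mod k ^ Suc t = b mod k ^ Suc t"
    using assms(1) arg_cong[OF s, of "\<lambda>z. z mod k ^ Suc t"]
    by (simp add: mod_mod_cancel le_imp_power_dvd Suc_le_eq del: power_Suc)
  ultimately show ?thesis
    unfolding a b by (metis div_mult_mod_eq)
qed

lemma card_le_1_digit_lines:
  assumes "digit_line k t u \<noteq> digit_line k s v"
  shows "card (digit_line k t u \<inter> digit_line k s v) \<le> 1"
proof (cases "t = s")
  case True
  have "digit_line k t u \<inter> digit_line k s v = {}"
  proof (rule ccontr)
    assume "\<not> ?thesis"
    then obtain w where "Suc w \<in> digit_line k t u" "Suc w \<in> digit_line k t v"
      using True by (auto simp: digit_line_def)
    then show False using assms True by (metis digit_line_eq_iff)
  qed
  then show ?thesis by simp
next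
  case False
  then have "x = y" if "x \<in> digit_line k t u \<inter> digit_line k s v"
    "y \<in> digit_line k t u \<inter> digit_line k s v" for x y
    using that digit_lines_meet_once[of t s] digit_lines_meet_once[of s t] by (metis Int_commute nat_neq_iff)
  then show ?thesis
    \<comment> \<open>Pairwise equality gives the bound for finite sets; an infinite set has
      cardinality 0 by convention.\<close>
    by (metis One_nat_def card_le_Suc0_iff_eq card.infinite zero_le)
qed

text \<open>Exactly one line in each direction \<open>t < d\<close> passes through a vertex. Equal
  lines in different directions would share all their \<open>k >= 2\<close> points, although they
  meet at most once.\<close>

lemma vertex_degree_digit_lines:
  assumes k: "k \<ge> 2" and n: "v \<in> {1..n}"
  shows "vertex_degree {digit_line k t u | t u. t < d \<and> u < n} v = d"
proof -
  obtain w where w: "v = Suc w" "w < n"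
    using n by (cases v) auto
  have self: "Suc w \<in> digit_line k t w" for t by (simp add: mem_digit_line_iff)
  have "{e \<in> {digit_line k t u | t u. t < d \<and> u < n}. v \<in> e} = (\<lambda>t. digit_line k t w) ` {..<d}"
    using w self by (auto simp: digit_line_eq_iff[symmetric] image_iff) (metis lessThan_iff)
  moreover have "inj_on (\<lambda>t. digit_line k t w) {..<d}"
  proof (rule linorder_inj_onI')
    fix t s :: nat assume "t < s"
    show "digit_line k t w \<noteq> digit_line k s w"
    proof
      assume "digit_line k t w = digit_line k s w"
      then have "x = y" if "x \<in> digit_line k t w" "y \<in> digit_line k t w" for x y
        using that \<open>t < s\<close> digit_lines_meet_once[of t s x k w w y] by simp
      then have "card (digit_line k t w) \<le> 1"
        by (metis One_nat_def card_le_Suc0_iff_eq card.infinite zero_le)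
      with k show False by (simp add: card_digit_line)
    qed
  qed
  ultimately show ?thesis
    by (simp add: vertex_degree_def card_image)
qed

section \<open>Attaining the bound when \<open>n\<close> is a power of \<open>k\<close>\<close>

theorem proposition3:
  fixes k n d :: nat
  assumes "k \<ge> 3" and "n \<ge> 1"
    and "log (real k) (real n) \<in> \<int>"
    and "1 \<le> d" and "real d \<le> log (real k) (real n)"
  shows "\<exists>E. uniform_hypergraph k n E \<and> regular_hypergraph d n E \<and>
           tensor_entropy k n E =
             Max {tensor_entropy k n E' | E'. uniform_hypergraph k n E' \<and> E' \<noteq> {}}"
proof -
  obtain z where z: "log (real k) (real n) = of_int z"
    using assms(3) by (auto elim: Ints_cases)
  define m where "m = nat z"
  \<comment> \<open>\<open>z >= d >= 1\<close>, so \<open>nat\<close> preserves the value.\<close>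
  have m: "log (real k) (real n) = real m"
    using z assms(4,5) by (simp add: m_def)
  have "real n = real k powr log (real k) (real n)"
    using assms(1,2) by (simp add: powr_log_cancel)
  also have "\<dots> = real (k ^ m)"
    using assms(1) by (simp add: m powr_realpow)
  finally have n: "n = k ^ m" by linarith
  have dm: "d \<le> m" using assms(5) m by simp
  define E where "E = {digit_line k t u | t u. t < d \<and> u < n}"
  have uniform: "uniform_hypergraph k n E"
    unfolding uniform_hypergraph_def E_def
  proof safe
    fix t u v assume "t < d" "u < n" "v \<in> digit_line k t u"
    then show "v \<in> {1..n}"
      using digit_line_subset[of t m u k] dm unfolding n by auto
  qed (use assms(1) in \<open>simp add: card_digit_line\<close>)
  have regular: "regular_hypergraph d n E"
    unfolding regular_hypergraph_def E_def
    using assms(1) by (intro ballI vertex_degree_digit_lines) auto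
  \<comment> \<open>The line in direction 0 through vertex 1 is available because
    \<open>d >= 1\<close> and \<open>n >= 1\<close>; it makes \<open>E\<close> one of the
    competitors in the maximum.\<close>
  have "digit_line k 0 0 \<in> E"
    using assms(2,4) unfolding E_def by (intro CollectI exI[of _ 0]) auto
  then have nonempty: "E \<noteq> {}" by auto
  have sparse: "card (e \<inter> f) < k - 1" if "e \<in> E" "f \<in> E" "e \<noteq> f" for e f
  proof -
    have "card (e \<inter> f) \<le> 1"
      using that card_le_1_digit_lines unfolding E_def by blast
    with assms(1) show ?thesis by linarith
  qed
  have entropy: "tensor_entropy k n E = ln n"
  proof (rule tensor_entropy_eq_ln)
    show "mode_singular_values k n E = replicate_mset n (sqrt ((real d)\<^sup>2 + d / fact (k - 1)))"
      unfolding mode_singular_values_def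
      by (intro singular_values_if_gram_scalar gram_laplacian_unfolding
          assms(1) uniform regular sparse)
    show "0 < sqrt ((real d)\<^sup>2 + d / fact (k - 1))"
      using assms(4) by (simp add: add_pos_pos)
  qed (fact assms(2))
  have "Max {tensor_entropy k n E' | E'. uniform_hypergraph k n E' \<and> E' \<noteq> {}} =
      tensor_entropy k n E"
  proof (rule Max_eqI)
    \<comment> \<open>\<open>Max\<close> is meaningful only for finite sets; there are finitely many
      hypergraphs on \<open>{1..n}\<close>.\<close>
    have "{tensor_entropy k n E' | E'. uniform_hypergraph k n E' \<and> E' \<noteq> {}}
        \<subseteq> tensor_entropy k n ` Pow (Pow {1..n})"
      by (auto simp: uniform_hypergraph_def intro!: imageI)
    then show "finite {tensor_entropy k n E' | E'. uniform_hypergraph k n E' \<and> E' \<noteq> {}}"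
      by (rule finite_subset) simp
  next
    fix y assume "y \<in> {tensor_entropy k n E' | E'. uniform_hypergraph k n E' \<and> E' \<noteq> {}}"
    then show "y \<le> tensor_entropy k n E"
      using tensor_entropy_le_ln[OF assms(2)] entropy by auto
  qed (use uniform nonempty in blast)
  then show ?thesis
    using uniform regular by metis
qed

end
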